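(* If $n\geqslant 2$ is an even integer, then there is an antichain of size $\dfrac{n!}{2^{n/2}}$ in the Bruhat order of $\mathcal{A}(n,2)$.
   Context: $\mathcal{A}(n,k)$ denotes the class of all $n\times n$ matrices with entries in $\{0,1\}$ in which every row and every column sums to $k$. For an $m\times n$ $(0,1)$-matrix $A=[a_{ij}]$ let $\sigma_{ij}(A)=\sum_{k=1}^{i}\sum_{\ell=1}^{j}a_{k\ell}$. For $A,C$ in the same class, $A\preceq_B C$ (Bruhat order) iff $\sigma_{ij}(A)\geqslant\sigma_{ij}(C)$ for all $i,j$. An antichain is a set of pairwise incomparable elements. *)

theory Defs
  imports Complex_Main "Jordan_Normal_Form.Matrix"
begin

definition zero_one_class :: "nat \<Rightarrow> nat \<Rightarrow> nat mat set" where
  "zero_one_class n k =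
     {A \<in> carrier_mat n n.
        (\<forall>i<n. \<forall>j<n. A $$ (i, j) \<in> {0, 1}) \<and>
        (\<forall>i<n. (\<Sum>j<n. A $$ (i, j)) = k) \<and>
        (\<forall>j<n. (\<Sum>i<n. A $$ (i, j)) = k)}"

text \<open>Matrix indices start at 0, so the entry \<open>A $$ (p, q)\<close> is the one in row \<open>p + 1\<close> and column
  \<open>q + 1\<close>. The arguments \<open>i\<close>, \<open>j\<close> of \<open>sigma\<close> count rows and columns: \<open>sigma A i j\<close> is the sum of
  the entries in the leading \<open>i\<close> by \<open>j\<close> submatrix.\<close>

definition sigma :: "nat mat \<Rightarrow> nat \<Rightarrow> nat \<Rightarrow> nat" where
  "sigma A i j = (\<Sum>p<i. \<Sum>q<j. A $$ (p, q))"

definition bruhat_le :: "nat mat \<Rightarrow> nat mat \<Rightarrow> bool"  (infix "\<preceq>\<^sub>B" 50) where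
  "A \<preceq>\<^sub>B C \<longleftrightarrow>
     dim_row A = dim_row C \<and> dim_col A = dim_col C \<and>
     (\<forall>i\<in>{1..dim_row A}. \<forall>j\<in>{1..dim_col A}. sigma A i j \<ge> sigma C i j)"

definition bruhat_antichain :: "nat mat set \<Rightarrow> bool" where
  "bruhat_antichain S \<longleftrightarrow> pairwise (\<lambda>A C. \<not> A \<preceq>\<^sub>B C \<and> \<not> C \<preceq>\<^sub>B A) S"

end

theory Submission
  imports Defs "HOL-Combinatorics.Multiset_Permutations"
begin

text \<open>Call a matrix palindromic if row \<open>p\<close> equals row \<open>n - 1 - p\<close>. For such a matrix with column
  sums \<open>k\<close> the first \<open>i\<close> and the first \<open>n - i\<close> rows satisfy
  \<open>sigma A i j + sigma A (n - i) j = j * k\<close>, so an inequality between the sums of two palindromic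
  matrices for \<open>n - i\<close> is the opposite inequality for \<open>i\<close>. Hence comparable palindromic matrices
  coincide. A palindromic matrix in the class with \<open>k = 2\<close> has exactly one entry 1 per column in its
  upper half, and is given by a word of length \<open>n\<close> in which each of the \<open>n / 2\<close> row indices occurs
  twice; there are \<open>n! / 2 ^ (n / 2)\<close> such words.\<close>

definition row_palindromic :: "nat mat \<Rightarrow> bool" where
  "row_palindromic A \<longleftrightarrow>
     (\<forall>p<dim_row A. \<forall>q<dim_col A. A $$ (dim_row A - Suc p, q) = A $$ (p, q))"

text \<open>Reflection carries the first \<open>i\<close> rows to the last \<open>i\<close> rows.
  Together with the first \<open>n - i\<close> rows these exhaust the matrix, so the two sums add up
  the first \<open>j\<close> columns in full.\<close>

lemma sigma_add_complement:
  assumes A: "A \<in> zero_one_class n k" and pal: "row_palindromic A"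
    and i: "i \<le> n" and j: "j \<le> n"
  shows "sigma A i j + sigma A (n - i) j = j * k"
proof -
  have dims: "dim_row A = n" "dim_col A = n"
    using A by (auto simp: zero_one_class_def)
  have "sigma A i j = (\<Sum>p<i. \<Sum>q<j. A $$ (n - Suc p, q))"
    unfolding sigma_def using pal i j dims
    by (intro sum.cong refl) (auto simp: row_palindromic_def)
  also have "\<dots> = (\<Sum>p\<in>{n - i..<n}. \<Sum>q<j. A $$ (p, q))"
    by (rule sum.reindex_bij_witness[of _ "\<lambda>p. n - Suc p" "\<lambda>p. n - Suc p"]) (use i in auto)
  finally have "sigma A i j + sigma A (n - i) j
      = (\<Sum>p\<in>{0..<n - i}. \<Sum>q<j. A $$ (p, q)) + (\<Sum>p\<in>{n - i..<n}. \<Sum>q<j. A $$ (p, q))"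
    by (simp add: sigma_def atLeast0LessThan)
  also have "\<dots> = (\<Sum>p<n. \<Sum>q<j. A $$ (p, q))"
    by (subst sum.atLeastLessThan_concat) (auto simp: atLeast0LessThan)
  also have "\<dots> = (\<Sum>q<j. \<Sum>p<n. A $$ (p, q))"
    by (rule sum.swap)
  also have "\<dots> = (\<Sum>q<j. k)"
    using A j by (intro sum.cong refl) (auto simp: zero_one_class_def)
  finally show ?thesis by simp
qed

text \<open>Inclusion-exclusion on leading submatrices, written without subtraction because it
  truncates on \<open>nat\<close>. It recovers each entry from \<open>sigma\<close>.\<close>

lemma entry_eq_sigma:
  "sigma A (Suc p) (Suc q) + sigma A p q = sigma A p (Suc q) + sigma A (Suc p) q + A $$ (p, q)"
  by (simp add: sigma_def sum.distrib)

lemma eq_if_sigma_eq: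
  assumes "A \<in> carrier_mat m n" "C \<in> carrier_mat m n"
    and eq: "\<And>i j. i \<le> m \<Longrightarrow> j \<le> n \<Longrightarrow> sigma A i j = sigma C i j"
  shows "A = C"
proof (rule eq_matI)
  fix p q assume "p < dim_row C" "q < dim_col C"
  with assms(2) have "p < m" "q < n" by auto
  then show "A $$ (p, q) = C $$ (p, q)"
    using entry_eq_sigma[of A p q] entry_eq_sigma[of C p q]
      eq[of p q] eq[of "Suc p" q] eq[of p "Suc q"] eq[of "Suc p" "Suc q"]
    by simp
qed (use assms in auto)

lemma row_palindromic_bruhat_le_imp_eq:
  assumes A: "A \<in> zero_one_class n k" "row_palindromic A"
    and C: "C \<in> zero_one_class n k" "row_palindromic C"
    and le: "A \<preceq>\<^sub>B C"
  shows "A = C"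
proof -
  have carr: "A \<in> carrier_mat n n" "C \<in> carrier_mat n n"
    using A C by (auto simp: zero_one_class_def)
  have ge: "sigma C i j \<le> sigma A i j" if "i \<le> n" "j \<le> n" for i j
  \<comment> \<open>\<open>bruhat_le\<close> speaks of positive indices only, but the complementary
    index \<open>n - i\<close> used below is 0 when \<open>i = n\<close>.\<close>
  proof (cases "i = 0 \<or> j = 0")
    case True
    then show ?thesis by (auto simp: sigma_def)
  next
    case False
    then show ?thesis using le that carr by (auto simp: bruhat_le_def)
  qed
  have "sigma A i j = sigma C i j" if "i \<le> n" "j \<le> n" for i j
    using sigma_add_complement[OF A that] sigma_add_complement[OF C that]
      ge[OF that] ge[of "n - i" j] that by simp
  with carr show ?thesis by (rule eq_if_sigma_eq)
qed

text \<open>The letter \<open>xs ! q\<close> names the row of the upper half that holds the 1 of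
  column \<open>q\<close>; \<open>min p (n - Suc p)\<close> folds row \<open>p\<close> onto the
  upper half.\<close>

definition palindromic_mat :: "nat \<Rightarrow> nat list \<Rightarrow> nat mat" where
  "palindromic_mat n xs = mat n n (\<lambda>(p, q). if xs ! q = min p (n - Suc p) then 1 else 0)"

lemma row_palindromic_palindromic_mat: "row_palindromic (palindromic_mat n xs)"
  by (auto simp: row_palindromic_def palindromic_mat_def min_def)

lemma palindromic_mat_in_class:
  assumes len: "length xs = 2 * m" and cnt: "\<And>i. i < m \<Longrightarrow> count (mset xs) i = 2"
    and lt: "set xs \<subseteq> {..<m}"
  shows "palindromic_mat (2 * m) xs \<in> zero_one_class (2 * m) 2"
proof -
  let ?n = "2 * m" and ?A = "palindromic_mat (2 * m) xs"
  have rows: "(\<Sum>q<?n. ?A $$ (p, q)) = 2" if p: "p < ?n" for p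
  proof -
    define r where "r = min p (?n - Suc p)"
    have "r < m" using p by (auto simp: r_def)
    have "(\<Sum>q<?n. ?A $$ (p, q)) = (\<Sum>q<?n. if xs ! q = r then 1 else 0)"
      using p by (intro sum.cong refl) (auto simp: palindromic_mat_def r_def)
    also have "\<dots> = card {q. q < ?n \<and> xs ! q = r}"
      by (simp add: sum.If_cases Int_def)
    also have "\<dots> = count (mset xs) r"
      by (simp add: count_mset count_list_eq_length_filter length_filter_conv_card len eq_commute)
    finally show ?thesis using cnt[OF \<open>r < m\<close>] by simp
  qed
  have cols: "(\<Sum>p<?n. ?A $$ (p, q)) = 2" if q: "q < ?n" for q
  proof -
    have x: "xs ! q < m" using lt q len by (metis lessThan_iff nth_mem subsetD)
    have "(\<Sum>p<?n. ?A $$ (p, q)) = (\<Sum>p<?n. if xs ! q = min p (?n - Suc p) then 1 else 0)"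
      using q by (intro sum.cong refl) (auto simp: palindromic_mat_def)
    also have "\<dots> = card {p. p < ?n \<and> xs ! q = min p (?n - Suc p)}"
      by (simp add: sum.If_cases Int_def)
    \<comment> \<open>As \<open>?n\<close> is even, reflection fixes no row: the two listed rows lie
      in different halves and hence are distinct.\<close>
    also have "{p. p < ?n \<and> xs ! q = min p (?n - Suc p)} = {xs ! q, ?n - Suc (xs ! q)}"
      using x by (auto simp: min_def)
    also have "card \<dots> = 2" using x by (subst card_2_iff) force
    finally show ?thesis .
  qed
  from rows cols show ?thesis
    unfolding zero_one_class_def by (auto simp: palindromic_mat_def)
qed

text \<open>Folding fixes the rows of the upper half, so a 1 at position \<open>(xs ! q, q)\<close>
  of the second matrix forces \<open>ys ! q = xs ! q\<close>.\<close>

lemma palindromic_mat_inj: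
  assumes "length xs = 2 * m" "length ys = 2 * m" and lt: "set xs \<subseteq> {..<m}"
    and eq: "palindromic_mat (2 * m) xs = palindromic_mat (2 * m) ys"
  shows "xs = ys"
proof (rule nth_equalityI)
  fix q assume q: "q < length xs"
  then have x: "xs ! q < m" using lt by (metis lessThan_iff nth_mem subsetD)
  then have "min (xs ! q) (2 * m - Suc (xs ! q)) = xs ! q" by simp
  with x q assms(1) have "palindromic_mat (2 * m) xs $$ (xs ! q, q) = 1"
    by (simp add: palindromic_mat_def)
  then have "palindromic_mat (2 * m) ys $$ (xs ! q, q) = 1" by (simp add: eq)
  with x q assms(1) show "xs ! q = ys ! q"
    by (auto simp: palindromic_mat_def split: if_splits)
qed (use assms in simp)

theorem theorem4:
  fixes n :: nat
  assumes "n \<ge> 2" and "even n"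
  shows "\<exists>S. S \<subseteq> zero_one_class n 2 \<and> bruhat_antichain S \<and>
           real (card S) = fact n / 2 ^ (n div 2)"
proof -
  obtain m where n: "n = 2 * m" using \<open>even n\<close> by (rule evenE)
  define M where "M = mset_set {..<m} + mset_set {..<m}"
  define W where "W = permutations_of_multiset M"
  have cntM: "count M i = 2" if "i < m" for i
    using that by (simp add: M_def)
  have setM: "set_mset M = {..<m}" and sizeM: "size M = 2 * m"
    by (simp_all add: M_def)
  have W: "length xs = 2 * m" "mset xs = M" "set xs = {..<m}" if "xs \<in> W" for xs
    using that setM sizeM unfolding W_def
    by (auto simp: permutations_of_multiset_def simp flip: set_mset_mset size_mset)
  define S where "S = palindromic_mat n ` W"
  have cls: "S \<subseteq> zero_one_class n 2"
    unfolding S_def n using W cntM by (auto intro!: palindromic_mat_in_class)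
  moreover have "bruhat_antichain S"
  proof -
    have "row_palindromic A" if "A \<in> S" for A
      using that row_palindromic_palindromic_mat by (auto simp: S_def)
    with cls row_palindromic_bruhat_le_imp_eq show ?thesis
      unfolding bruhat_antichain_def pairwise_def by blast
  qed
  moreover have "real (card S) = fact n / 2 ^ (n div 2)"
  proof -
    have "inj_on (palindromic_mat n) W"
      by (rule inj_onI) (use W in \<open>auto simp: n intro: palindromic_mat_inj\<close>)
    then have "card S = card W" by (simp add: S_def card_image)
    have "card W * 2 ^ m = fact n"
      \<comment> \<open>The multinomial count: \<open>card W\<close> times the product of
        \<open>fact (count M i)\<close> over the \<open>m\<close> letters is
        \<open>fact (size M)\<close>, and each factor is \<open>fact 2 = 2\<close>.\<close>
      using card_permutations_of_multiset_aux[of M]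
      by (simp add: W_def n setM sizeM cntM)
    then have "real (card W) * 2 ^ m = fact n"
      by (metis of_nat_fact of_nat_mult of_nat_numeral of_nat_power)
    then have "real (card W) = fact n / 2 ^ m"
      by (simp add: field_simps)
    with \<open>card S = card W\<close> show ?thesis by (simp add: n)
  qed
  ultimately show ?thesis by blast
qed

end
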